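(* Let $m\geqslant 1$ be an integer. The generalized friendship graph $F(3,m)$ is maximal if and only if $3m$ or $3m/2$ is a square-free integer.
   Context: All graphs are finite and simple. The rank of a graph is the rank (over the reals) of its adjacency matrix. A graph is reduced if it has no isolated vertex and no two distinct vertices with the same set of neighbors. A reduced graph $G$ is maximal if it is not a proper induced subgraph of any reduced graph with the same rank as $G$ (equivalently, every reduced graph containing $G$ as a proper induced subgraph has a higher rank). The generalized friendship graph $F(k,m)$ is the graph on $mk+1$ vertices obtained by adding a new vertex to $m$ disjoint copies of the complete graph $K_k$ and joining it to all the vertices of these copies. An integer is square-free if it is not divisible by the square of any integer greater than $1$; the condition "$3m/2$ is a square-free integer" includes the requirement that $m$ is even. *)

theory Defs
  imports
    "Graph_Theory.Graph_Theory"
    "Jordan_Normal_Form.DL_Rank"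
    "HOL-Computational_Algebra.Squarefree"
begin

text \<open>
  A finite simple graph is a \<open>pair_graph\<close>: an edge \<open>{u, v}\<close> is the pair of arcs
  \<open>(u, v)\<close>, \<open>(v, u)\<close>.
\<close>

text \<open>
  Rows and columns follow the increasing order of the vertices; another order would conjugate
  the matrix by a permutation, so the rank does not depend on this choice.
\<close>

definition adjacency_matrix :: "'a :: linorder pair_pre_digraph \<Rightarrow> real mat" where
  "adjacency_matrix G =
    (let vs = sorted_list_of_set (pverts G); n = card (pverts G)
     in mat n n (\<lambda>(i, j). if (vs ! i, vs ! j) \<in> parcs G then 1 else 0))"

definition graph_rank :: "'a :: linorder pair_pre_digraph \<Rightarrow> nat" where
  "graph_rank G = vec_space.rank (card (pverts G)) (adjacency_matrix G)"

definition nbrs :: "'a pair_pre_digraph \<Rightarrow> 'a \<Rightarrow> 'a set" where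
  "nbrs G v = {u. (v, u) \<in> parcs G}"

definition reduced :: "'a pair_pre_digraph \<Rightarrow> bool" where
  "reduced G \<longleftrightarrow> pair_graph G \<and> (\<forall>v \<in> pverts G. nbrs G v \<noteq> {}) \<and> inj_on (nbrs G) (pverts G)"

text \<open>
  Vertices are natural numbers. Since there are infinitely many of them, every finite graph with
  an induced subgraph isomorphic to \<open>G\<close> is isomorphic to one that has \<open>G\<close> itself as an induced
  subgraph. Hence the quantifier over \<open>H\<close> loses nothing. On a finite vertex type it would.
\<close>

definition maximal_graph :: "nat pair_pre_digraph \<Rightarrow> bool" where
  "maximal_graph G \<longleftrightarrow> reduced G \<and>
    \<not> (\<exists>H :: nat pair_pre_digraph. reduced H \<and> graph_rank H = graph_rank G \<and>
          induced_subgraph (with_proj G) (with_proj H) \<and> pverts G \<noteq> pverts H)"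

definition clique_block :: "nat \<Rightarrow> nat \<Rightarrow> nat set" where
  "clique_block k i = {i * k + 1 .. i * k + k}"

text \<open>The added vertex is \<open>0\<close>; the \<open>i\<close>-th copy of the complete graph lives on \<open>clique_block k i\<close>.\<close>

definition gen_friendship :: "nat \<Rightarrow> nat \<Rightarrow> nat pair_pre_digraph" where
  "gen_friendship k m =
    (let B = (\<Union>i<m. clique_block k i)
     in \<lparr> pverts = insert 0 B,
          parcs = (\<Union>i<m. {(u, v). u \<in> clique_block k i \<and> v \<in> clique_block k i \<and> u \<noteq> v})
                  \<union> {0} \<times> B \<union> B \<times> {0} \<rparr>)"

lemma UN_clique_block: "(\<Union>i<m. clique_block k i) = {1..m * k}"
  by (induction m) (auto simp: clique_block_def lessThan_Suc)

lemma card_gen_friendship: "card (pverts (gen_friendship k m)) = m * k + 1"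
  by (simp add: gen_friendship_def Let_def UN_clique_block)

lemma pair_graph_gen_friendship: "pair_graph (gen_friendship k m)"
proof -
  let ?G = "gen_friendship k m"
  have sub: "parcs ?G \<subseteq> pverts ?G \<times> pverts ?G" and fin: "finite (pverts ?G)"
    by (auto simp: gen_friendship_def Let_def clique_block_def)
  have "finite (parcs ?G)"
    using finite_subset[OF sub] fin by blast
  moreover have "symmetric (with_proj ?G)"
    by (auto simp: symmetric_def gen_friendship_def Let_def sym_def)
  moreover have "fst e \<noteq> snd e" if "e \<in> parcs ?G" for e
    using that by (auto simp: gen_friendship_def Let_def clique_block_def)
  ultimately show ?thesis
    using sub fin by unfold_locales auto
qed

end

theory Submission
  imports Defs
begin

text \<open>
  The adjacency matrix \<open>A\<close> of \<open>F(3, m)\<close> is nonsingular. For a graph \<open>G\<close> with nonsingular adjacency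
  matrix \<open>A\<close>, a larger graph \<open>H\<close> has the same rank exactly when every column of a new vertex is a
  combination of the columns of the old vertices. If \<open>X\<close> is the set of old neighbours of a new
  vertex and \<open>x\<close> its indicator vector, this says that the solution \<open>c\<close> of \<open>A c = x\<close> also satisfies
  \<open>c \<bullet> x = 0\<close>, because a vertex is not adjacent to itself. Conversely every such \<open>X\<close> gives an
  extension by one vertex, and this extension is reduced unless \<open>X\<close> is empty or is already the
  neighbourhood of a vertex of \<open>G\<close>. So \<open>G\<close> is maximal iff all solutions \<open>X\<close> of \<open>c \<bullet> x = 0\<close> are
  of these trivial kinds (\<open>maximal_graph_nonsingular_iff\<close>).

  For \<open>F(3, m)\<close> the system \<open>A c = x\<close> can be solved by hand. Write \<open>a \<in> {0, 1}\<close> for the entry of \<open>x\<close>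
  at the central vertex and \<open>s i \<in> {0, \<dots>, 3}\<close> for the number of elements of \<open>X\<close> in the \<open>i\<close>-th
  triangle. Then \<open>c \<bullet> x = 0\<close> becomes the Diophantine equation
  \<open>3 m N = k\<^sup>2\<close> with \<open>N = (\<Sum>i. s i (s i - 2))\<close> and \<open>k = (\<Sum>i. s i) - 2 a\<close>
  (\<open>friendship_solution_orthogonal_iff\<close>), in which \<open>N \<equiv> k\<close> modulo 2.

  Suppose that \<open>3 m\<close> or \<open>3 m / 2\<close> is square-free. Then \<open>3 m\<close> divides \<open>k\<close>, where in the second case
  the parity of \<open>N - k\<close> supplies the missing factor 2. As \<open>-2 \<le> k \<le> 3 m\<close>, only \<open>k = 0\<close> and
  \<open>k = 3 m\<close> remain, and these force the empty set or an old neighbourhood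
  (\<open>admissible_profile_cases\<close>). Otherwise \<open>3 m = b\<^sup>2 e\<close> with \<open>b \<ge> 2\<close> and \<open>e (b - 1)\<close> even, and
  \<open>k = b e\<close>, \<open>N = e\<close>, \<open>a = 1\<close> is realised by a suitable choice of triangles meeting \<open>X\<close> in 1, 2 or 3
  vertices (\<open>exists_admissible_profile\<close>), which is a genuinely new neighbourhood.
\<close>

section \<open>Columns of the adjacency matrix and the rank of a graph\<close>

definition adj :: "'a pair_pre_digraph \<Rightarrow> 'a \<Rightarrow> 'a \<Rightarrow> real" where
  "adj G w u = of_bool ((w, u) \<in> parcs G)"

text \<open>
  Independence is stated for the family of columns indexed by \<open>U\<close>, not for a set of vectors, so it
  includes that distinct vertices of \<open>U\<close> have distinct columns. The sums are indexed by vertices,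
  which keeps the enumeration of the vertices out of all later arguments.
\<close>

definition indep_cols :: "'a pair_pre_digraph \<Rightarrow> 'a set \<Rightarrow> bool" where
  "indep_cols G U \<longleftrightarrow>
    (\<forall>c. (\<forall>w\<in>pverts G. (\<Sum>u\<in>U. c u * adj G w u) = 0) \<longrightarrow> (\<forall>u\<in>U. c u = 0))"

lemma indep_colsD:
  assumes "indep_cols G U" "\<forall>w\<in>pverts G. (\<Sum>u\<in>U. c u * adj G w u) = 0" "u \<in> U"
  shows "c u = 0"
  using assms(1)[unfolded indep_cols_def, THEN spec, of c] assms(2,3) by blast

definition in_col_span :: "'a pair_pre_digraph \<Rightarrow> 'a set \<Rightarrow> 'a \<Rightarrow> bool" where
  "in_col_span G U v \<longleftrightarrow> (\<exists>c. \<forall>w\<in>pverts G. adj G w v = (\<Sum>u\<in>U. c u * adj G w u))"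

definition adj_col :: "'a :: linorder pair_pre_digraph \<Rightarrow> 'a \<Rightarrow> real vec" where
  "adj_col G v = vec (card (pverts G)) (\<lambda>i. adj G (sorted_list_of_set (pverts G) ! i) v)"

lemma adjacency_matrix_carrier:
  "adjacency_matrix G \<in> carrier_mat (card (pverts G)) (card (pverts G))"
  by (simp add: adjacency_matrix_def Let_def)

lemma set_cols_adjacency_matrix:
  assumes "finite (pverts G)"
  shows "set (cols (adjacency_matrix G)) = adj_col G ` pverts G"
proof -
  let ?vs = "sorted_list_of_set (pverts G)"
  have "cols (adjacency_matrix G) = map (adj_col G) ?vs"
    by (rule nth_equalityI)
      (auto simp: adjacency_matrix_def Let_def adj_col_def adj_def intro!: eq_vecI)
  then show ?thesis using assms by simp
qed

lemma adj_col_nth: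
  assumes "i < card (pverts G)"
  shows "adj_col G v $ i = adj G (sorted_list_of_set (pverts G) ! i) v"
  using assms by (simp add: adj_col_def)

lemma adj_col_carrier [simp]: "adj_col G v \<in> carrier_vec (card (pverts G))"
  by (simp add: adj_col_def)

lemma sum_of_bool_eq_mult:
  fixes f :: "'a \<Rightarrow> 'b :: semiring_1"
  assumes "finite U" "u \<in> U"
  shows "(\<Sum>x\<in>U. of_bool (x = u) * f x) = f u"
proof -
  have "(\<Sum>x\<in>U. of_bool (x = u) * f x) = (\<Sum>x\<in>U. if x = u then f x else 0)"
    by (rule sum.cong) auto
  then show ?thesis using assms by simp
qed

lemma indep_cols_imp_inj_on:
  assumes "indep_cols G U" "finite U"
    and "\<And>w. w \<in> pverts G \<Longrightarrow> adj G w u = adj G w v" "u \<in> U" "v \<in> U"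
  shows "u = v"
proof (rule ccontr)
  assume "u \<noteq> v"
  define c :: "'a \<Rightarrow> real" where "c = (\<lambda>x. of_bool (x = u) - of_bool (x = v))"
  have "\<forall>w\<in>pverts G. (\<Sum>x\<in>U. c x * adj G w x) = 0"
    unfolding c_def left_diff_distrib sum_subtractf
    using assms(3) by (simp add: sum_of_bool_eq_mult assms(2,4,5))
  from indep_colsD[OF assms(1) this] have "c u = 0" using assms by blast
  then show False using \<open>u \<noteq> v\<close> by (simp add: c_def)
qed

lemma indep_cols_imp_nonzero:
  assumes "indep_cols G U" "finite U" "u \<in> U"
  shows "\<exists>w\<in>pverts G. adj G w u \<noteq> 0"
proof (rule ccontr)
  assume "\<not> ?thesis"
  then have "\<forall>w\<in>pverts G. (\<Sum>x\<in>U. of_bool (x = u) * adj G w x) = 0"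
    by (simp add: sum_of_bool_eq_mult assms(2,3))
  from indep_colsD[OF assms(1) this assms(3)] have "of_bool (u = u) = (0 :: real)" .
  then show False by simp
qed

lemma inj_on_adj_col:
  assumes "indep_cols G U" "finite (pverts G)" "U \<subseteq> pverts G"
  shows "inj_on (adj_col G) U"
proof (rule inj_onI)
  fix u v assume uv: "u \<in> U" "v \<in> U" "adj_col G u = adj_col G v"
  have "adj G w u = adj G w v" if "w \<in> pverts G" for w
  proof -
    have "w \<in> set (sorted_list_of_set (pverts G))" using that assms(2) by simp
    then obtain i where "i < card (pverts G)" "w = sorted_list_of_set (pverts G) ! i"
      unfolding in_set_conv_nth length_sorted_list_of_set by blast
    then show ?thesis using adj_col_nth[of i G u] adj_col_nth[of i G v] uv(3) by simp
  qed
  then show "u = v"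
    by (rule indep_cols_imp_inj_on[OF assms(1) finite_subset[OF assms(3,2)] _ uv(1,2)])
qed

context
  fixes G :: "'a :: linorder pair_pre_digraph"
  assumes finV: "finite (pverts G)"
begin

interpretation vec_space "TYPE(real)" "card (pverts G)" .

text \<open>
  The bridge between vectors indexed by positions and functions on vertices: an identity of vectors
  is an identity at each vertex.
\<close>

lemma lincomb_adj_col_eq_iff:
  assumes "inj_on (adj_col G) U" "x \<in> carrier_vec (card (pverts G))"
    and "\<And>i. i < card (pverts G) \<Longrightarrow> x $ i = f (sorted_list_of_set (pverts G) ! i)" "finite U"
  shows "x = lincomb a (adj_col G ` U) \<longleftrightarrow>
    (\<forall>w\<in>pverts G. f w = (\<Sum>u\<in>U. a (adj_col G u) * adj G w u))"
proof -
  let ?vs = "sorted_list_of_set (pverts G)" and ?n = "card (pverts G)"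
  have sub: "adj_col G ` U \<subseteq> carrier_vec ?n" by auto
  have ix: "lincomb a (adj_col G ` U) $ i = (\<Sum>u\<in>U. a (adj_col G u) * adj G (?vs ! i) u)"
    if "i < ?n" for i
    using that assms(1) by (simp add: lincomb_index[OF that sub] sum.reindex adj_col_nth)
  have "x = lincomb a (adj_col G ` U) \<longleftrightarrow> (\<forall>i<?n. x $ i = lincomb a (adj_col G ` U) $ i)"
    using assms(2) lincomb_dim[OF finite_imageI[OF assms(4)] sub, of a] by (auto intro!: eq_vecI)
  also have "\<dots> \<longleftrightarrow> (\<forall>i<?n. f (?vs ! i) = (\<Sum>u\<in>U. a (adj_col G u) * adj G (?vs ! i) u))"
    using assms(3) ix by auto
  also have "\<dots> \<longleftrightarrow> (\<forall>w\<in>set ?vs. f w = (\<Sum>u\<in>U. a (adj_col G u) * adj G w u))"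
    by (simp add: all_set_conv_all_nth)
  finally show ?thesis unfolding set_sorted_list_of_set[OF finV] .
qed

lemma lin_indpt_adj_cols:
  assumes "indep_cols G U" "U \<subseteq> pverts G"
  shows "lin_indpt (adj_col G ` U)"
proof
  assume "lin_dep (adj_col G ` U)"
  have finU: "finite U" by (rule finite_subset[OF assms(2) finV])
  have SC: "adj_col G ` U \<subseteq> carrier_vec (card (pverts G))" by auto
  obtain a v where a: "lincomb a (adj_col G ` U) = 0\<^sub>v (card (pverts G))"
    and v: "v \<in> adj_col G ` U" "a v \<noteq> 0"
    using finite_lin_dep[OF finite_imageI[OF finU] \<open>lin_dep _\<close> SC] by auto
  obtain u where u: "u \<in> U" "v = adj_col G u" using v(1) by blast
  have "\<forall>w\<in>pverts G. 0 = (\<Sum>u\<in>U. a (adj_col G u) * adj G w u)"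
  proof (rule iffD1[OF lincomb_adj_col_eq_iff[OF inj_on_adj_col[OF assms(1) finV assms(2)]]])
    show "0\<^sub>v (card (pverts G)) = lincomb a (adj_col G ` U)" by (rule a[symmetric])
  qed (use finU in auto)
  then have "\<forall>w\<in>pverts G. (\<Sum>u\<in>U. a (adj_col G u) * adj G w u) = 0"
    by (metis (no_types, lifting))
  from indep_colsD[where c = "\<lambda>u. a (adj_col G u)", OF assms(1) this u(1)] v(2) u(2)
  show False by simp
qed

lemma adj_col_in_span_iff:
  assumes "indep_cols G U" "U \<subseteq> pverts G"
  shows "adj_col G v \<in> span (adj_col G ` U) \<longleftrightarrow> in_col_span G U v"
proof -
  have finU: "finite U" by (rule finite_subset[OF assms(2) finV])
  have inj: "inj_on (adj_col G) U" by (rule inj_on_adj_col[OF assms(1) finV assms(2)])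
  have "adj_col G v \<in> span (adj_col G ` U) \<longleftrightarrow> (\<exists>a. adj_col G v = lincomb a (adj_col G ` U))"
  proof -
    have "adj_col G ` U \<subseteq> carrier_vec (card (pverts G))" by auto
    from finite_span[OF finite_imageI[OF finU] this] show ?thesis by simp
  qed
  also have "\<dots> \<longleftrightarrow> (\<exists>a. \<forall>w\<in>pverts G. adj G w v = (\<Sum>u\<in>U. a (adj_col G u) * adj G w u))"
    by (subst lincomb_adj_col_eq_iff[OF inj adj_col_carrier adj_col_nth finU]) (assumption, rule refl)
  also have "\<dots> \<longleftrightarrow> in_col_span G U v"
  proof
    assume "in_col_span G U v"
    then obtain c where c: "\<forall>w\<in>pverts G. adj G w v = (\<Sum>u\<in>U. c u * adj G w u)"
      by (auto simp: in_col_span_def)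
    define a where "a = (\<lambda>x. c (the_inv_into U (adj_col G) x))"
    have a: "a (adj_col G u) = c u" if "u \<in> U" for u
      using that by (simp add: a_def the_inv_into_f_f[OF inj])
    have "(\<Sum>u\<in>U. a (adj_col G u) * adj G w u) = (\<Sum>u\<in>U. c u * adj G w u)" for w
      by (rule sum.cong) (simp_all add: a)
    with c have "\<forall>w\<in>pverts G. adj G w v = (\<Sum>u\<in>U. a (adj_col G u) * adj G w u)" by simp
    then show "\<exists>a. \<forall>w\<in>pverts G. adj G w v = (\<Sum>u\<in>U. a (adj_col G u) * adj G w u)"
      by (rule exI[of _ a])
  next
    assume "\<exists>a. \<forall>w\<in>pverts G. adj G w v = (\<Sum>u\<in>U. a (adj_col G u) * adj G w u)"
    then obtain a where "\<forall>w\<in>pverts G. adj G w v = (\<Sum>u\<in>U. a (adj_col G u) * adj G w u)"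
      by (rule exE)
    then show "in_col_span G U v"
      unfolding in_col_span_def by (rule exI[of _ "\<lambda>u. a (adj_col G u)"])
  qed
  finally show ?thesis .
qed

text \<open>
  The two facts about rank that are needed later: an independent family that spans all columns
  computes the rank, and an independent family whose size is the rank spans all columns, since
  otherwise one more column could be added to it.
\<close>

lemma graph_rank_eq_card:
  assumes "indep_cols G U" "U \<subseteq> pverts G" "\<And>v. v \<in> pverts G \<Longrightarrow> in_col_span G U v"
  shows "graph_rank G = card U"
proof -
  let ?S = "adj_col G ` U"
  have SC: "?S \<subseteq> carrier_vec (card (pverts G))" by auto
  note li = lin_indpt_adj_cols[OF assms(1,2)]
  have "maximal ?S (\<lambda>T. T \<subseteq> set (cols (adjacency_matrix G)) \<and> lin_indpt T)"
    unfolding maximal_def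
  proof (intro conjI allI impI)
    show "?S \<subseteq> set (cols (adjacency_matrix G))"
      using assms(2) set_cols_adjacency_matrix[OF finV] by auto
    show "lin_indpt ?S" by (rule li)
    fix T assume T: "?S \<subseteq> T \<and> T \<subseteq> set (cols (adjacency_matrix G)) \<and> lin_indpt T"
    show "T = ?S"
    proof (rule ccontr)
      assume "T \<noteq> ?S"
      then obtain x where x: "x \<in> T" "x \<notin> ?S" using T by blast
      then obtain v where v: "v \<in> pverts G" "x = adj_col G v"
        using T set_cols_adjacency_matrix[OF finV] by blast
      then have "x \<in> span ?S" using assms(3) adj_col_in_span_iff[OF assms(1,2)] by blast
      then have "lin_dep (?S \<union> {x})"
        using lin_dep_iff_in_span[OF SC li _ x(2)] v by auto
      then show False using T x subset_li_is_li[of T "?S \<union> {x}"] by simp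
    qed
  qed
  then have "rank (adjacency_matrix G) = card ?S"
    by (rule rank_card_indpt[OF adjacency_matrix_carrier])
  also have "\<dots> = card U" by (rule card_image[OF inj_on_adj_col[OF assms(1) finV assms(2)]])
  finally show ?thesis by (simp add: graph_rank_def)
qed

lemma in_col_span_if_card_eq_rank:
  assumes "indep_cols G U" "U \<subseteq> pverts G" "graph_rank G = card U" "v \<in> pverts G"
  shows "in_col_span G U v"
proof (rule ccontr)
  let ?S = "adj_col G ` U"
  assume "\<not> in_col_span G U v"
  then have nin: "adj_col G v \<notin> span ?S" using adj_col_in_span_iff[OF assms(1,2)] by blast
  have SC: "?S \<subseteq> carrier_vec (card (pverts G))" by auto
  have v: "adj_col G v \<notin> ?S" using nin subsetD[OF in_own_span[OF SC]] by (auto simp del: image_iff)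
  have "lin_indpt (?S \<union> {adj_col G v})"
    using lin_dep_iff_in_span[OF SC lin_indpt_adj_cols[OF assms(1,2)] _ v] nin by simp
  then have "card (?S \<union> {adj_col G v}) \<le> rank (adjacency_matrix G)"
    using assms(2,4) set_cols_adjacency_matrix[OF finV]
    by (intro rank_ge_card_indpt[OF adjacency_matrix_carrier]) auto
  moreover have "card (?S \<union> {adj_col G v}) = card U + 1"
    using v card_image[OF inj_on_adj_col[OF assms(1) finV assms(2)]]
      finite_subset[OF assms(2) finV] by simp
  ultimately show False using assms(3) by (simp add: graph_rank_def)
qed

end

section \<open>Extensions of graphs with nonsingular adjacency matrix\<close>

lemma adj_sym:
  assumes "pair_graph G"
  shows "adj G u w = adj G w u"
proof -
  interpret pair_graph G by (rule assms)
  show ?thesis using pair_sym_arcs by (auto simp: adj_def symmetric_def sym_def)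
qed

lemma nbrs_eq_iff_adj_eq:
  assumes "pair_graph G"
  shows "nbrs G u = nbrs G v \<longleftrightarrow> (\<forall>w\<in>pverts G. adj G w u = adj G w v)"
proof -
  interpret pair_graph G by (rule assms)
  have "nbrs G u = {w \<in> pverts G. adj G w u = 1}" for u
    using in_arcsD2 by (auto simp: nbrs_def adj_sym[OF assms, of _ u]) (auto simp: adj_def)
  then show ?thesis by (auto simp: adj_def)
qed

lemma nbrs_eq_empty_iff_adj_eq_0:
  assumes "pair_graph G"
  shows "nbrs G v = {} \<longleftrightarrow> (\<forall>w\<in>pverts G. adj G w v = 0)"
proof -
  interpret pair_graph G by (rule assms)
  show ?thesis
    using in_arcsD2 by (auto simp: nbrs_def adj_sym[OF assms, of _ v]) (auto simp: adj_def)
qed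

lemma induced_subgraph_adj:
  assumes "induced_subgraph (with_proj G) (with_proj H)" "u \<in> pverts G" "w \<in> pverts G"
  shows "adj H w u = adj G w u"
  using assms by (auto simp: induced_subgraph_def adj_def)

lemma indep_cols_induced_subgraph:
  assumes ind: "induced_subgraph (with_proj G) (with_proj H)" and li: "indep_cols G (pverts G)"
  shows "indep_cols H (pverts G)"
  unfolding indep_cols_def
proof (intro allI impI ballI)
  fix c u
  assume H: "\<forall>w\<in>pverts H. (\<Sum>u\<in>pverts G. c u * adj H w u) = 0" and u: "u \<in> pverts G"
  have sub: "pverts G \<subseteq> pverts H" using ind by (auto simp: induced_subgraph_def subgraph_def)
  have "(\<Sum>u\<in>pverts G. c u * adj G w u) = 0" if "w \<in> pverts G" for w
  proof -
    have "(\<Sum>u\<in>pverts G. c u * adj G w u) = (\<Sum>u\<in>pverts G. c u * adj H w u)"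
      by (rule sum.cong) (simp_all add: induced_subgraph_adj[OF ind _ that])
    then show ?thesis using H that sub by auto
  qed
  then show "c u = 0" by (intro indep_colsD[OF li _ u]) blast
qed

lemma in_col_span_self:
  assumes "finite U" "u \<in> U"
  shows "in_col_span G U u"
  unfolding in_col_span_def
  by (rule exI[of _ "\<lambda>x. of_bool (x = u)"]) (simp add: sum_of_bool_eq_mult[OF assms])

lemma indep_cols_unique:
  assumes li: "indep_cols G U" and u: "u \<in> U"
    and eq: "\<And>w. w \<in> pverts G \<Longrightarrow> (\<Sum>u\<in>U. c u * adj G w u) = (\<Sum>u\<in>U. d u * adj G w u)"
  shows "c u = d u"
proof -
  have "\<forall>w\<in>pverts G. (\<Sum>u\<in>U. (c u - d u) * adj G w u) = 0"
    by (simp add: left_diff_distrib sum_subtractf eq)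
  from indep_colsD[where c = "\<lambda>u. c u - d u", OF li this u] show ?thesis by simp
qed

text \<open>
  An isolated vertex would give a zero column, and two vertices with the same neighbours would give
  two equal columns.
\<close>

lemma reduced_if_indep_cols:
  assumes "pair_graph G" "indep_cols G (pverts G)"
  shows "reduced G"
proof -
  interpret pair_graph G by (rule assms)
  note fin = pair_finite_verts
  show ?thesis unfolding reduced_def
  proof (intro conjI ballI inj_onI)
    show "nbrs G v \<noteq> {}" if "v \<in> pverts G" for v
      using indep_cols_imp_nonzero[OF assms(2) fin that] nbrs_eq_empty_iff_adj_eq_0[OF assms(1)] by blast
    show "u = v" if "u \<in> pverts G" "v \<in> pverts G" "nbrs G u = nbrs G v" for u v
      using that nbrs_eq_iff_adj_eq[OF assms(1)]
      by (intro indep_cols_imp_inj_on[OF assms(2) fin]) blast+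
  qed (rule assms(1))
qed

definition add_vertex :: "'a pair_pre_digraph \<Rightarrow> 'a \<Rightarrow> 'a set \<Rightarrow> 'a pair_pre_digraph" where
  "add_vertex G v X = \<lparr>pverts = insert v (pverts G), parcs = parcs G \<union> X \<times> {v} \<union> {v} \<times> X\<rparr>"

lemma pair_graph_add_vertex:
  assumes "pair_graph G" "X \<subseteq> pverts G" "v \<notin> pverts G"
  shows "pair_graph (add_vertex G v X)"
proof -
  interpret pair_graph G by (rule assms)
  have fX: "finite X" using assms(2) pair_finite_verts by (rule finite_subset)
  show ?thesis
  proof unfold_locales
    show "finite (pverts (add_vertex G v X))" "finite (parcs (add_vertex G v X))"
      using pair_finite_verts pair_finite_arcs fX by (auto simp: add_vertex_def)
    show "symmetric (with_proj (add_vertex G v X))"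
      using pair_sym_arcs by (auto simp: add_vertex_def symmetric_def sym_def)
    fix e assume e: "e \<in> parcs (add_vertex G v X)"
    show "fst e \<in> pverts (add_vertex G v X)" "snd e \<in> pverts (add_vertex G v X)"
      using e assms(2) arc_fst_in_verts arc_snd_in_verts by (auto simp: add_vertex_def)
    show "fst e \<noteq> snd e" using e assms(2,3) pair_no_loops by (auto simp: add_vertex_def)
  qed
qed

lemma pair_graph_imp_wf_digraph:
  assumes "pair_graph G"
  shows "wf_digraph (with_proj G)"
proof -
  interpret pair_graph G by (rule assms)
  show ?thesis by (rule wf_digraph_axioms)
qed

lemma pair_graph_arcsD:
  assumes "pair_graph G" "(x, y) \<in> parcs G"
  shows "x \<in> pverts G \<and> y \<in> pverts G"
proof -
  interpret pair_graph G by (rule assms)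
  show ?thesis using assms(2) in_arcsD1 in_arcsD2 by blast
qed

lemma induced_subgraph_add_vertex:
  assumes "pair_graph G" "X \<subseteq> pverts G" "v \<notin> pverts G"
  shows "induced_subgraph (with_proj G) (with_proj (add_vertex G v X))"
proof -
  note wf = pair_graph_imp_wf_digraph[OF assms(1)]
    pair_graph_imp_wf_digraph[OF pair_graph_add_vertex[OF assms]]
  have "parcs G = {e \<in> parcs (add_vertex G v X). fst e \<in> pverts G \<and> snd e \<in> pverts G}"
    using assms(3) pair_graph_arcsD[OF assms(1)] by (auto simp: add_vertex_def)
  moreover have "subgraph (with_proj G) (with_proj (add_vertex G v X))"
    unfolding subgraph_def compatible_def
    by (intro conjI wf) (auto simp: add_vertex_def)
  ultimately show ?thesis unfolding induced_subgraph_def with_proj_simps by blast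
qed

lemma adj_add_vertex:
  assumes "pair_graph G" "X \<subseteq> pverts G" "v \<notin> pverts G" "w \<in> pverts G"
  shows "adj (add_vertex G v X) w v = of_bool (w \<in> X)"
    and "adj (add_vertex G v X) v w = of_bool (w \<in> X)"
    and "adj (add_vertex G v X) v v = 0"
proof -
  interpret pair_graph G by (rule assms)
  show "adj (add_vertex G v X) w v = of_bool (w \<in> X)"
    "adj (add_vertex G v X) v w = of_bool (w \<in> X)" "adj (add_vertex G v X) v v = 0"
    using assms in_arcsD1 in_arcsD2 by (auto simp: adj_def add_vertex_def)
qed

lemma graph_rank_if_indep_cols:
  assumes "finite (pverts G)" "indep_cols G (pverts G)"
  shows "graph_rank G = card (pverts G)"
  by (rule graph_rank_eq_card[OF assms(1,2) subset_refl in_col_span_self[OF assms(1)]])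

text \<open>
  The new column restricted to the old vertices is \<open>A c\<close>; its last entry is 0, as the new vertex has
  no loop, and \<open>c\<close> reproduces this entry exactly when the sum of \<open>c\<close> over \<open>X\<close> vanishes.
\<close>

lemma graph_rank_add_vertex:
  fixes G :: "'a :: linorder pair_pre_digraph"
  assumes G: "pair_graph G" and li: "indep_cols G (pverts G)"
    and X: "X \<subseteq> pverts G" and v: "v \<notin> pverts G"
    and col: "\<And>w. w \<in> pverts G \<Longrightarrow> of_bool (w \<in> X) = (\<Sum>u\<in>pverts G. c u * adj G w u)"
    and orth: "(\<Sum>u\<in>X. c u) = 0"
  shows "graph_rank (add_vertex G v X) = card (pverts G)"
proof (rule graph_rank_eq_card)
  let ?H = "add_vertex G v X"
  interpret pair_graph G by (rule G)
  note fin = pair_finite_verts and ind = induced_subgraph_add_vertex[OF G X v]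
  have pH: "pverts ?H = insert v (pverts G)" by (simp add: add_vertex_def)
  show "finite (pverts ?H)" "pverts G \<subseteq> pverts ?H" using fin by (auto simp: pH)
  show "indep_cols ?H (pverts G)" by (rule indep_cols_induced_subgraph[OF ind li])
  fix u assume "u \<in> pverts ?H"
  then consider "u = v" | "u \<in> pverts G" by (auto simp: pH)
  then show "in_col_span ?H (pverts G) u"
  proof cases
    case 1
    have old: "adj ?H w v = (\<Sum>u\<in>pverts G. c u * adj ?H w u)" if w: "w \<in> pverts G" for w
    proof -
      have "(\<Sum>u\<in>pverts G. c u * adj ?H w u) = (\<Sum>u\<in>pverts G. c u * adj G w u)"
        by (rule sum.cong) (simp_all add: induced_subgraph_adj[OF ind _ w])
      then show ?thesis using col[OF w] adj_add_vertex(1)[OF G X v w] by simp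
    qed
    have "(\<Sum>u\<in>pverts G. c u * adj ?H v u) = (\<Sum>u\<in>pverts G. if u \<in> X then c u else 0)"
      by (rule sum.cong) (simp_all add: adj_add_vertex(2)[OF G X v])
    also have "\<dots> = (\<Sum>u\<in>X. c u)"
      using X fin by (simp add: sum.inter_restrict[symmetric] Int_absorb1)
    finally have new: "adj ?H v v = (\<Sum>u\<in>pverts G. c u * adj ?H v u)"
      using orth v by (auto simp: adj_def add_vertex_def dest: in_arcsD1 subsetD[OF X])
    show ?thesis unfolding 1 in_col_span_def pH
      by (rule exI[of _ c]) (use old new in blast)
  next
    case 2
    then show ?thesis by (rule in_col_span_self[OF fin])
  qed
qed

lemma reduced_add_vertex:
  assumes G: "pair_graph G" and li: "indep_cols G (pverts G)"
    and X: "X \<subseteq> pverts G" and v: "v \<notin> pverts G"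
    and ne: "X \<noteq> {}" and new: "\<And>u. u \<in> pverts G \<Longrightarrow> nbrs G u \<noteq> X"
  shows "reduced (add_vertex G v X)"
proof -
  let ?H = "add_vertex G v X"
  interpret pair_graph G by (rule G)
  note fin = pair_finite_verts and ind = induced_subgraph_add_vertex[OF G X v]
  have gH: "pair_graph ?H" by (rule pair_graph_add_vertex[OF G X v])
  have li': "indep_cols ?H (pverts G)" by (rule indep_cols_induced_subgraph[OF ind li])
  have nv: "nbrs ?H v = X"
    using v in_arcsD1 X by (auto simp: nbrs_def add_vertex_def)
  have nu: "nbrs ?H u \<noteq> X" if u: "u \<in> pverts G" for u
  proof
    assume eq: "nbrs ?H u = X"
    have "u \<notin> X" using eq v X u by (auto simp: nbrs_def add_vertex_def)
    then have "nbrs G u = X" using eq u v by (auto simp: nbrs_def add_vertex_def)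
    then show False using new[OF u] by simp
  qed
  show ?thesis unfolding reduced_def
  proof (intro conjI ballI inj_onI gH)
    fix u assume "u \<in> pverts ?H"
    then consider "u = v" | "u \<in> pverts G" by (auto simp: add_vertex_def)
    then show "nbrs ?H u \<noteq> {}"
    proof cases
      case 2
      then show ?thesis
        using indep_cols_imp_nonzero[OF li' fin] nbrs_eq_empty_iff_adj_eq_0[OF gH] by blast
    qed (use nv ne in simp)
  next
    fix u w assume uw: "u \<in> pverts ?H" "w \<in> pverts ?H" and eq: "nbrs ?H u = nbrs ?H w"
    have pH: "pverts ?H = insert v (pverts G)" by (simp add: add_vertex_def)
    show "u = w"
    proof (cases "u = v \<or> w = v")
      case True
      then show ?thesis using uw eq nv nu unfolding pH by (metis insertE)
    next
      case False
      then have "u \<in> pverts G" "w \<in> pverts G" using uw pH by auto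
      moreover have "\<And>x. x \<in> pverts ?H \<Longrightarrow> adj ?H x u = adj ?H x w"
        using eq nbrs_eq_iff_adj_eq[OF gH] by blast
      ultimately show ?thesis by (intro indep_cols_imp_inj_on[OF li' fin])
    qed
  qed
qed

text \<open>
  If \<open>H\<close> is a reduced extension of the same rank with several new vertices, a single one of them
  already leads to a contradiction: its column in \<open>H\<close> is a combination of the old columns, and the
  coefficients are determined by the restriction to \<open>G\<close>. If this restriction is zero or an old
  column of \<open>G\<close>, the same holds for the whole column in \<open>H\<close>, so \<open>H\<close> has an isolated vertex or twins.
\<close>

lemma maximal_graph_nonsingular_iff:
  fixes G :: "nat pair_pre_digraph"
  assumes G: "pair_graph G" and li: "indep_cols G (pverts G)"
  shows "maximal_graph G \<longleftrightarrow>
    (\<forall>X c. X \<subseteq> pverts G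
        \<longrightarrow> (\<forall>w\<in>pverts G. of_bool (w \<in> X) = (\<Sum>u\<in>pverts G. c u * adj G w u))
        \<longrightarrow> (\<Sum>u\<in>X. c u) = 0
        \<longrightarrow> X = {} \<or> (\<exists>u\<in>pverts G. nbrs G u = X))"
    (is "_ \<longleftrightarrow> ?only_old")
proof
  interpret pair_graph G by (rule G)
  note fin = pair_finite_verts
  note rk = graph_rank_if_indep_cols[OF fin li]
  {
    assume max: "maximal_graph G"
    show ?only_old
    proof (intro allI impI)
      fix X and c :: "nat \<Rightarrow> real"
      assume X: "X \<subseteq> pverts G" and orth: "(\<Sum>u\<in>X. c u) = 0"
        and col: "\<forall>w\<in>pverts G. of_bool (w \<in> X) = (\<Sum>u\<in>pverts G. c u * adj G w u)"
      show "X = {} \<or> (\<exists>u\<in>pverts G. nbrs G u = X)"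
      proof (rule ccontr)
        assume new: "\<not> ?thesis"
        obtain v where v: "v \<notin> pverts G" using ex_new_if_finite[OF infinite_UNIV_nat fin] by blast
        let ?H = "add_vertex G v X"
        have "reduced ?H" by (rule reduced_add_vertex[OF G li X v]) (use new in blast)+
        moreover have "graph_rank ?H = graph_rank G"
          unfolding rk by (rule graph_rank_add_vertex[OF G li X v _ orth]) (use col in blast)
        moreover note induced_subgraph_add_vertex[OF G X v]
        moreover have "pverts G \<noteq> pverts ?H" using v by (auto simp: add_vertex_def)
        ultimately show False using max unfolding maximal_graph_def by blast
      qed
    qed
  next
    assume only: ?only_old
    show "maximal_graph G" unfolding maximal_graph_def
    proof (intro conjI notI reduced_if_indep_cols[OF G li])
      assume "\<exists>H. reduced H \<and> graph_rank H = graph_rank G \<and>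
        induced_subgraph (with_proj G) (with_proj H) \<and> pverts G \<noteq> pverts H"
      then obtain H where red: "reduced H" and rkH: "graph_rank H = card (pverts G)"
        and ind: "induced_subgraph (with_proj G) (with_proj H)" and ne: "pverts G \<noteq> pverts H"
        unfolding rk by blast
      have H: "pair_graph H" using red by (simp add: reduced_def)
      interpret H: pair_graph H by (rule H)
      have sub: "pverts G \<subseteq> pverts H" using ind by (auto simp: induced_subgraph_def subgraph_def)
      have liH: "indep_cols H (pverts G)" by (rule indep_cols_induced_subgraph[OF ind li])
      obtain v where v: "v \<in> pverts H" "v \<notin> pverts G" using sub ne by blast
      have "in_col_span H (pverts G) v"
        by (rule in_col_span_if_card_eq_rank[OF H.pair_finite_verts liH sub rkH v(1)])
      then obtain c where c: "\<forall>w\<in>pverts H. adj H w v = (\<Sum>u\<in>pverts G. c u * adj H w u)"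
        unfolding in_col_span_def by (rule exE)
      define X where "X = {w \<in> pverts G. (w, v) \<in> parcs H}"
      have X: "X \<subseteq> pverts G" by (auto simp: X_def)
      have ofX: "of_bool (w \<in> X) = adj H w v" if "w \<in> pverts G" for w
        using that by (simp add: X_def adj_def)
      have colG: "of_bool (w \<in> X) = (\<Sum>u\<in>pverts G. c u * adj G w u)" if w: "w \<in> pverts G" for w
      proof -
        have "(\<Sum>u\<in>pverts G. c u * adj G w u) = (\<Sum>u\<in>pverts G. c u * adj H w u)"
          by (rule sum.cong) (simp_all add: induced_subgraph_adj[OF ind _ w])
        also have "\<dots> = adj H w v" using c w sub by (metis subsetD)
        finally show ?thesis using ofX[OF w] by simp
      qed
      have "(\<Sum>u\<in>X. c u) = (\<Sum>u\<in>pverts G. if u \<in> X then c u else 0)"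
        using X fin by (simp add: sum.inter_restrict[symmetric] Int_absorb1)
      also have "\<dots> = (\<Sum>u\<in>pverts G. c u * adj H v u)"
        by (rule sum.cong) (simp_all add: adj_sym[OF H, of v] ofX[symmetric])
      also have "\<dots> = adj H v v" using c v(1) by metis
      also have "\<dots> = 0" using H.pair_no_loops[of "(v, v)"] by (auto simp: adj_def)
      finally have orth: "(\<Sum>u\<in>X. c u) = 0" .
      have "X = {} \<or> (\<exists>u\<in>pverts G. nbrs G u = X)"
        using only[THEN spec, THEN spec, of X c] X colG orth by blast
      then show False
      proof
        assume "X = {}"
        have c0: "c u = 0" if "u \<in> pverts G" for u
        proof (rule indep_cols_unique[OF li that])
          fix w assume "w \<in> pverts G"
          then show "(\<Sum>u\<in>pverts G. c u * adj G w u) = (\<Sum>u\<in>pverts G. 0 * adj G w u)"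
            using colG[of w] \<open>X = {}\<close> by simp
        qed
        have "\<forall>w\<in>pverts H. adj H w v = 0"
        proof
          fix w assume w: "w \<in> pverts H"
          have "(\<Sum>u\<in>pverts G. c u * adj H w u) = 0" by (rule sum.neutral) (simp add: c0)
          then show "adj H w v = 0" using c w by metis
        qed
        then show False
          using nbrs_eq_empty_iff_adj_eq_0[OF H] red v(1) unfolding reduced_def by blast
      next
        assume "\<exists>u\<in>pverts G. nbrs G u = X"
        then obtain z where z: "z \<in> pverts G" "nbrs G z = X" by blast
        have cz: "c u = of_bool (u = z)" if "u \<in> pverts G" for u
        proof (rule indep_cols_unique[OF li that])
          fix w assume w: "w \<in> pverts G"
          have "(\<Sum>u\<in>pverts G. of_bool (u = z) * adj G w u) = adj G w z"
            by (rule sum_of_bool_eq_mult[OF fin z(1)])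
          also have "\<dots> = of_bool (w \<in> X)"
            unfolding adj_sym[OF G, of w z] by (auto simp: adj_def z(2)[symmetric] nbrs_def)
          finally show "(\<Sum>u\<in>pverts G. c u * adj G w u)
              = (\<Sum>u\<in>pverts G. of_bool (u = z) * adj G w u)"
            using colG[OF w] by simp
        qed
        have "\<forall>w\<in>pverts H. adj H w v = adj H w z"
        proof
          fix w assume w: "w \<in> pverts H"
          have "(\<Sum>u\<in>pverts G. c u * adj H w u) = (\<Sum>u\<in>pverts G. of_bool (u = z) * adj H w u)"
            by (rule sum.cong) (simp_all add: cz)
          also have "\<dots> = adj H w z" by (rule sum_of_bool_eq_mult[OF fin z(1)])
          finally show "adj H w v = adj H w z" using c w by metis
        qed
        then have "nbrs H v = nbrs H z" using nbrs_eq_iff_adj_eq[OF H] by blast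
        then have "v = z" using red v(1) z(1) sub unfolding reduced_def inj_on_def by blast
        then show False using v(2) z(1) by simp
      qed
    qed
  }
qed

section \<open>The Diophantine equation\<close>

text \<open>
  Cancel \<open>g = gcd d k\<close>: with \<open>d = d' g\<close> the number \<open>d'\<close> is coprime to \<open>k / g\<close> but divides \<open>g (k / g)\<^sup>2\<close>,
  hence it divides \<open>g\<close>, and \<open>d'\<^sup>2\<close> divides \<open>d\<close>.
\<close>

lemma squarefree_dvd_square_imp_dvd:
  fixes d k :: nat
  assumes "squarefree d" "d dvd k\<^sup>2"
  shows "d dvd k"
proof -
  have "d \<noteq> 0" using assms(1) not_squarefree_0 by metis
  then have g: "gcd d k \<noteq> 0" by simp
  obtain d' k' where d: "d = d' * gcd d k" and k: "k = k' * gcd d k" and cop: "coprime d' k'"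
    using gcd_coprime_exists[OF g] by blast
  have "gcd d k * d' dvd gcd d k * (gcd d k * k'\<^sup>2)"
    using assms(2) d k by (metis mult.assoc mult.commute power2_eq_square)
  then have "d' dvd gcd d k * k'\<^sup>2" using g by (simp only: nat_mult_dvd_cancel_disj simp_thms)
  then have "d' dvd gcd d k"
    using cop by (simp add: coprime_dvd_mult_left_iff)
  then have "d' * d' dvd d" using d by (metis mult_dvd_mono dvd_refl)
  then have "d' = 1" using squarefreeD[OF assms(1), of d'] by (simp add: power2_eq_square)
  then show ?thesis using d by (metis gcd_dvd2 mult_1)
qed

lemma squarefree_int_dvd_square_imp_dvd:
  assumes "squarefree d" "int d dvd k\<^sup>2"
  shows "int d dvd k"
proof -
  have "int d dvd int ((nat \<bar>k\<bar>)\<^sup>2)" using assms(2) by simp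
  then have "d dvd (nat \<bar>k\<bar>)\<^sup>2" by (simp only: int_dvd_int_iff)
  then have "d dvd nat \<bar>k\<bar>" by (rule squarefree_dvd_square_imp_dvd[OF assms(1)])
  then show ?thesis by simp
qed

text \<open>
  For \<open>n = 2 d\<close> with \<open>d\<close> square-free only \<open>k = d c\<close> is clear, and then \<open>2 N = d c\<^sup>2\<close>. If \<open>c\<close> were odd, \<open>d\<close>
  would be even, hence \<open>k\<close> and \<open>N\<close> too, and \<open>4\<close> would divide \<open>d\<close>.
\<close>

lemma dvd_of_square_multiple:
  fixes n :: nat and k N :: int
  assumes sf: "squarefree n \<or> (even n \<and> squarefree (n div 2))"
    and eq: "int n * N = k\<^sup>2" and par: "even (N - k)"
  shows "int n dvd k"
  using sf
proof
  assume "squarefree n"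
  moreover have "int n dvd k\<^sup>2" using eq by (metis dvd_triv_left)
  ultimately show ?thesis by (rule squarefree_int_dvd_square_imp_dvd)
next
  assume "even n \<and> squarefree (n div 2)"
  then obtain d where n: "n = 2 * d" and d: "squarefree d" by auto
  have "k\<^sup>2 = int d * (2 * N)" using eq n by simp
  then have "int d dvd k\<^sup>2" by simp
  then have "int d dvd k" by (rule squarefree_int_dvd_square_imp_dvd[OF d])
  then obtain c where c: "k = int d * c" by auto
  have d0: "d \<noteq> 0" using d not_squarefree_0 by metis
  have "int d * (2 * N) = int d * (int d * c\<^sup>2)"
    using eq n c by (simp add: power2_eq_square algebra_simps)
  then have N: "2 * N = int d * c\<^sup>2" using d0 by simp
  have "even c"
  proof (rule ccontr)
    assume oc: "odd c"
    have "even (int d * c\<^sup>2)" using N by (metis dvd_triv_left)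
    then have "even d" using oc by simp
    then obtain e where e: "d = 2 * e" by (rule evenE)
    have "N = int e * c\<^sup>2" using N e by simp
    moreover have "even N" using par c e by simp
    ultimately have "even e" using oc by simp
    then obtain f where "e = 2 * f" by (rule evenE)
    then have "2\<^sup>2 dvd d" using e by simp
    then have "(2 :: nat) dvd 1" by (rule squarefreeD[OF d])
    then show False by simp
  qed
  then obtain c' where "c = 2 * c'" by (rule evenE)
  then have "k = int n * c'" using c n by simp
  then show ?thesis by simp
qed

text \<open>
  The pair \<open>(a, \<sigma>)\<close> records how the neighbourhood of a new vertex meets the central vertex and each
  of the \<open>m\<close> triangles. The equation is the condition that the rank stays the same.
\<close>

definition admissible_profile :: "nat \<Rightarrow> int \<Rightarrow> (nat \<Rightarrow> int) \<Rightarrow> bool" where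
  "admissible_profile m a \<sigma> \<longleftrightarrow> a \<in> {0, 1} \<and> (\<forall>i<m. \<sigma> i \<in> {0..3}) \<and>
    3 * int m * (\<Sum>i<m. \<sigma> i * (\<sigma> i - 2)) = ((\<Sum>i<m. \<sigma> i) - 2 * a)\<^sup>2"

text \<open>
  The three cases are the empty set, the neighbourhood of the central vertex, and the neighbourhood
  of a vertex of triangle \<open>j\<close>.
\<close>

lemma admissible_profile_cases:
  assumes m: "m \<ge> 1" and sf: "squarefree (3 * m) \<or> (even m \<and> squarefree (3 * m div 2))"
    and adm: "admissible_profile m a \<sigma>"
  obtains (zero) "a = 0" "\<And>i. i < m \<Longrightarrow> \<sigma> i = 0"
    | (full) "a = 0" "\<And>i. i < m \<Longrightarrow> \<sigma> i = 3"
    | (edge) j where "a = 1" "j < m" "\<And>i. i < m \<Longrightarrow> \<sigma> i = (if i = j then 2 else 0)"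
proof -
  define s where "s = (\<Sum>i<m. \<sigma> i)"
  define N where "N = (\<Sum>i<m. \<sigma> i * (\<sigma> i - 2))"
  define k where "k = s - 2 * a"
  have a: "a \<in> {0, 1}" and rg: "\<And>i. i < m \<Longrightarrow> 0 \<le> \<sigma> i \<and> \<sigma> i \<le> 3"
    and eq: "3 * int m * N = k\<^sup>2"
    using adm by (auto simp: admissible_profile_def s_def N_def k_def)
  have "N - s = (\<Sum>i<m. \<sigma> i * (\<sigma> i - 3))"
    by (simp add: N_def s_def sum_subtractf[symmetric] algebra_simps)
  also have "even \<dots>" by (intro dvd_sum) auto
  finally have par: "even (N - k)" by (simp add: k_def)
  have s0: "0 \<le> s" unfolding s_def using rg by (intro sum_nonneg) auto
  have "s \<le> of_nat (card {..<m}) * 3"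
    unfolding s_def using rg by (intro sum_bounded_above) auto
  then have s3: "s \<le> 3 * int m" by simp
  have "int (3 * m) dvd k"
    by (rule dvd_of_square_multiple[where N = N]) (use sf eq par in auto)
  then obtain c where c: "k = 3 * int m * c" by auto
  have "c < 2"
  proof (rule ccontr)
    assume "\<not> c < 2"
    then have "3 * int m * 2 \<le> k" unfolding c by (intro mult_left_mono) auto
    then show False using s3 a m by (auto simp: k_def)
  qed
  moreover have "c > -1"
  proof (rule ccontr)
    assume "\<not> c > -1"
    then have "k \<le> 3 * int m * (-1)" unfolding c by (intro mult_left_mono) auto
    then show False using s0 a m by (auto simp: k_def)
  qed
  ultimately consider "c = 0" | "c = 1" by linarith
  then show thesis
  proof cases
    case 1
    then have s: "s = 2 * a" and N: "N = 0" using c eq m by (auto simp: k_def)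
    show thesis
    proof (cases "a = 0")
      case True
      then have "\<forall>i\<in>{..<m}. \<sigma> i = 0"
        using s rg by (subst sum_nonneg_eq_0_iff[symmetric]) (auto simp: s_def)
      then show thesis using True zero by simp
    next
      case False
      then have a1: "a = 1" using a by simp
      have "\<exists>j<m. \<sigma> j \<ge> 2"
      proof (rule ccontr)
        assume small: "\<not> (\<exists>j<m. \<sigma> j \<ge> 2)"
        have "\<sigma> i * (\<sigma> i - 2) = - \<sigma> i" if "i < m" for i
        proof -
          have "\<sigma> i = 0 \<or> \<sigma> i = 1" using rg[OF that] small that by force
          then show ?thesis by auto
        qed
        then have "N = - s" by (simp add: N_def s_def sum_negf)
        then show False using N s a1 by simp
      qed
      then obtain j where j: "j < m" "\<sigma> j \<ge> 2" by blast
      have "s = \<sigma> j + (\<Sum>i\<in>{..<m} - {j}. \<sigma> i)"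
        unfolding s_def using j by (simp add: sum.remove)
      moreover have "(\<Sum>i\<in>{..<m} - {j}. \<sigma> i) \<ge> 0" using rg by (intro sum_nonneg) auto
      ultimately have "\<sigma> j = 2" "(\<Sum>i\<in>{..<m} - {j}. \<sigma> i) = 0" using s a1 j by auto
      moreover from this have "\<forall>i\<in>{..<m} - {j}. \<sigma> i = 0"
        using rg by (subst sum_nonneg_eq_0_iff[symmetric]) auto
      ultimately show thesis using a1 j edge by auto
    qed
  next
    case 2
    then have "s = 3 * int m" and a0: "a = 0" using s3 a c by (auto simp: k_def)
    then have "(\<Sum>i<m. 3 - \<sigma> i) = 0" by (simp add: sum_subtractf s_def)
    then have "\<forall>i\<in>{..<m}. 3 - \<sigma> i = 0"
      using rg by (subst sum_nonneg_eq_0_iff[symmetric]) auto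
    then show thesis using full a0 by simp
  qed
qed

lemma sum_of_bool_less:
  assumes "n \<le> m"
  shows "(\<Sum>i<m. of_bool (i < n)) = (of_nat n :: 'a :: semiring_1)"
proof -
  have "{..<m} \<inter> {i. i < n} = {..<n}" using assms by auto
  then show ?thesis by (simp add: of_bool_def sum.If_cases)
qed

text \<open>
  A triangle that meets \<open>X\<close> in 1, 2 or 3 vertices contributes \<open>-1\<close>, \<open>0\<close> or \<open>3\<close> to \<open>N\<close>. The counts \<open>p\<close>,
  \<open>q\<close> and \<open>r\<close> of such triangles can be prescribed freely.
\<close>

lemma exists_step_profile:
  assumes "r + p + q \<le> m"
  obtains \<sigma> :: "nat \<Rightarrow> int" where "\<And>i. \<sigma> i \<in> {0..3}" "\<And>i. i < r \<Longrightarrow> \<sigma> i = 3"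
    "(\<Sum>i<m. \<sigma> i) = 3 * int r + int p + 2 * int q"
    "(\<Sum>i<m. \<sigma> i * (\<sigma> i - 2)) = 3 * int r - int p"
proof
  let ?\<sigma> = "\<lambda>i. if i < r then 3 else if i < r + p then 1 else if i < r + p + q then 2 else (0 :: int)"
  have "(\<Sum>i<m. ?\<sigma> i) = (\<Sum>i<m. 2 * of_bool (i < r) - of_bool (i < r + p) + 2 * of_bool (i < r + p + q))"
    by (intro sum.cong) auto
  also have "\<dots> = 2 * int r - int (r + p) + 2 * int (r + p + q)"
    using assms by (simp add: sum.distrib sum_subtractf sum_distrib_left[symmetric] sum_of_bool_less
      del: of_nat_add sum_of_bool_eq)
  finally show "(\<Sum>i<m. ?\<sigma> i) = 3 * int r + int p + 2 * int q" by simp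
  have "(\<Sum>i<m. ?\<sigma> i * (?\<sigma> i - 2)) = (\<Sum>i<m. 4 * of_bool (i < r) - of_bool (i < r + p))"
    by (intro sum.cong) auto
  also have "\<dots> = 4 * int r - int (r + p)"
    using assms by (simp add: sum_subtractf sum_distrib_left[symmetric] sum_of_bool_less
      del: of_nat_add sum_of_bool_eq)
  finally show "(\<Sum>i<m. ?\<sigma> i * (?\<sigma> i - 2)) = 3 * int r - int p" by simp
qed auto

text \<open>
  For \<open>k = b e\<close> and \<open>N = e\<close> the congruence \<open>N \<equiv> k\<close> modulo 2 demands that \<open>e (b - 1)\<close> is even. For odd
  \<open>m\<close> the factor \<open>b\<close> is odd; for even \<open>m\<close> the square is split off from \<open>3 m / 2\<close>, which leaves \<open>e\<close> even.
\<close>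

lemma square_factor_with_parity:
  assumes m: "m \<ge> 1" and nsf: "\<not> squarefree (3 * m)" "\<not> (even m \<and> squarefree (3 * m div 2))"
  obtains b e :: nat where "3 * m = b\<^sup>2 * e" "b \<ge> 2" "even (e * (b - 1))"
proof (cases "even m")
  case True
  then obtain x where x: "x\<^sup>2 dvd 3 * m div 2" "\<not> x dvd 1"
    using nsf(2) not_squarefreeE by blast
  then obtain e where e: "3 * m div 2 = x\<^sup>2 * e" by blast
  have "3 * m = x\<^sup>2 * (2 * e)" using e True by auto
  moreover have "x \<ge> 2"
  proof -
    have "x \<noteq> 0" using e True m by (auto elim!: evenE intro: ccontr)
    moreover have "x \<noteq> 1" using x(2) by auto
    ultimately show ?thesis by simp
  qed
  ultimately show ?thesis using that by simp
next
  case False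
  then obtain x where x: "x\<^sup>2 dvd 3 * m" "\<not> x dvd 1"
    using nsf(1) not_squarefreeE by blast
  then obtain e where e: "3 * m = x\<^sup>2 * e" by blast
  have "odd (3 * m)" using False by simp
  then have "odd x" using e by simp
  moreover have "x \<noteq> 0" using \<open>odd x\<close> by (metis even_zero)
  moreover have "x \<noteq> 1" using x(2) by (metis dvd_refl)
  ultimately show ?thesis using that[OF e] by simp
qed

text \<open>
  With \<open>a = 1\<close>, the counts must satisfy \<open>3 r - p = e\<close> and \<open>p + 2 q + 3 r = b e + 2\<close>, that is
  \<open>p + q = h + 1\<close> where \<open>2 h = e (b - 1)\<close>. The choice of \<open>p\<close> as the residue of \<open>-e\<close> modulo 3 is the
  smallest that makes \<open>r\<close> an integer. It remains to check \<open>p \<le> h + 1\<close> and \<open>r + h + 1 \<le> m\<close>; the latter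
  amounts to \<open>e (2 b - 1) (b - 1) \<ge> 6 + 2 p\<close>. Both hold with \<open>a = 1\<close> without exception, while \<open>a = 0\<close>
  would require \<open>p \<le> h\<close> and fail for \<open>m = 3\<close>.
\<close>

lemma exists_admissible_profile:
  assumes m: "m \<ge> 1" and nsf: "\<not> squarefree (3 * m)" "\<not> (even m \<and> squarefree (3 * m div 2))"
  obtains \<sigma> where "admissible_profile m 1 \<sigma>" "\<exists>i<m. \<sigma> i = 3"
proof -
  obtain b e :: nat where mbe: "3 * m = b\<^sup>2 * e" and b: "b \<ge> 2" and ev: "even (e * (b - 1))"
    using square_factor_with_parity[OF assms] .
  have e0: "e \<ge> 1" using mbe m by (cases e) auto
  (* 2 e is congruent to -e modulo 3, and this form avoids subtraction. *)
  define p where "p = (2 * e) mod 3"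
  define r where "r = (e + p) div 3"
  have p2: "p \<le> 2" by (simp add: p_def)
  have r: "3 * r = e + p" unfolding r_def p_def by presburger
  obtain h where h: "e * (b - 1) = 2 * h" using evenE[OF ev] .
  have eb: "e * b = 2 * h + e" using h b by (cases b) auto
  (* If 3 does not divide e, it divides b, because it divides b^2 e. *)
  have b3: "b \<ge> 3" if "p \<noteq> 0"
  proof -
    have "\<not> 3 dvd e" using that by (auto simp: p_def)
    moreover have "prime (3 :: nat)" by simp
    moreover have "3 dvd b\<^sup>2 * e" using mbe by (metis dvd_triv_left)
    ultimately have "3 dvd b" by (metis prime_dvd_mult_iff prime_dvd_power)
    then show ?thesis using b by (auto elim!: dvdE)
  qed
  have ph: "p \<le> h + 1"
  proof (cases "p = 0")
    case False
    have "e * 2 \<le> e * (b - 1)" using b3[OF False] by (intro mult_left_mono) auto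
    then have "e \<le> h" using h by (metis mult.commute mult_le_cancel1 zero_less_numeral)
    then show ?thesis using e0 p2 by simp
  qed simp
  have cap: "r + (h + 1) \<le> m"
  proof -
    have ibe: "3 * int m = int b * int b * int e" using arg_cong[OF mbe, of int]
      by (simp add: power2_eq_square)
    have key: "int e * ((2 * int b - 1) * (int b - 1)) \<ge> 6 + 2 * int p"
    proof (cases "p = 0")
      case True
      then have "3 dvd e" by (simp add: p_def) presburger
      then have "int e \<ge> 3" using e0 by (auto elim!: dvdE)
      moreover have "(2 * int b - 1) * (int b - 1) \<ge> 3 * 1" using b by (intro mult_mono) auto
      ultimately have "int e * ((2 * int b - 1) * (int b - 1)) \<ge> 3 * (3 * 1)"
        by (rule mult_mono) (use b in \<open>auto intro: mult_nonneg_nonneg\<close>)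
      then show ?thesis using True by simp
    next
      case False
      have "(2 * int b - 1) * (int b - 1) \<ge> 5 * 2" using b3[OF False] by (intro mult_mono) auto
      then have "int e * ((2 * int b - 1) * (int b - 1)) \<ge> 1 * (5 * 2)"
        using mult_mono[of 1 "int e" "5 * 2" "(2 * int b - 1) * (int b - 1)"] e0 by simp
      then show ?thesis using p2 by simp
    qed
    have "int e * ((2 * int b - 1) * (int b - 1)) = 2 * (int b * int b * int e) - 3 * (int e * int b) + int e"
      by (simp add: algebra_simps)
    also have "\<dots> = 6 * int m - 3 * (2 * int h + int e) + int e"
      using ibe arg_cong[OF eb, of int] by simp
    finally have "6 * int m \<ge> 6 + 2 * int p + 6 * int h + 2 * int e" using key by simp
    moreover have "3 * int r = int e + int p" using arg_cong[OF r, of int] by simp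
    ultimately have "6 * (int r + (int h + 1)) \<le> 6 * int m" by presburger
    then show ?thesis by simp
  qed
  have "r + p + (h + 1 - p) \<le> m" using ph cap by simp
  then obtain \<sigma> :: "nat \<Rightarrow> int" where \<sigma>: "\<And>i. \<sigma> i \<in> {0..3}" "\<And>i. i < r \<Longrightarrow> \<sigma> i = 3"
    and sums: "(\<Sum>i<m. \<sigma> i) = 3 * int r + int p + 2 * int (h + 1 - p)"
      "(\<Sum>i<m. \<sigma> i * (\<sigma> i - 2)) = 3 * int r - int p"
    using exists_step_profile[OF \<open>r + p + (h + 1 - p) \<le> m\<close>] by blast
  have r': "3 * int r = int e + int p" using arg_cong[OF r, of int] by simp
  have "(\<Sum>i<m. \<sigma> i) - 2 = int e * int b"
    using sums(1) r' ph arg_cong[OF eb, of int] by (simp add: of_nat_diff)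
  moreover have "(\<Sum>i<m. \<sigma> i * (\<sigma> i - 2)) = int e" using sums(2) r' by simp
  moreover have "3 * int m = (int b)\<^sup>2 * int e" using arg_cong[OF mbe, of int] by simp
  ultimately have "admissible_profile m 1 \<sigma>"
    using \<sigma>(1) by (simp add: admissible_profile_def power2_eq_square)
  moreover have "0 < r" using r e0 by simp
  then have "\<exists>i<m. \<sigma> i = 3" using \<sigma>(2) cap by (intro exI[of _ 0]) auto
  ultimately show thesis by (rule that)
qed

section \<open>Generalized friendship graphs of triangles\<close>

lemma mem_clique_block_3_iff: "u \<in> clique_block 3 i \<longleftrightarrow> u \<noteq> 0 \<and> (u - 1) div 3 = i"
proof (cases u)
  case (Suc v)
  have "v div 3 = i \<longleftrightarrow> i * 3 \<le> v \<and> v < i * 3 + 3"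
    using div_nat_eqI[of 3 i v] div_mult_mod_eq[of v 3] mod_less_divisor[of 3 v] by auto
  then show ?thesis using Suc by (auto simp: clique_block_def)
qed (simp add: clique_block_def)

lemma card_clique_block: "card (clique_block k i) = k"
  by (simp add: clique_block_def)

lemma finite_clique_block: "finite (clique_block k i)"
  by (simp add: clique_block_def)

lemma pverts_friendship: "pverts (gen_friendship 3 m) = insert 0 (\<Union>i<m. clique_block 3 i)"
  by (simp add: gen_friendship_def Let_def)

lemma finite_pverts_friendship: "finite (pverts (gen_friendship 3 m))"
  by (simp add: pverts_friendship finite_clique_block)

lemma sum_pverts_friendship:
  fixes f :: "nat \<Rightarrow> real"
  shows "(\<Sum>u\<in>pverts (gen_friendship 3 m). f u) = f 0 + (\<Sum>i<m. \<Sum>u\<in>clique_block 3 i. f u)"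
proof -
  have "0 \<notin> (\<Union>i<m. clique_block 3 i)" by (simp add: mem_clique_block_3_iff)
  moreover have "(\<Sum>u\<in>(\<Union>i<m. clique_block 3 i). f u) = (\<Sum>i<m. \<Sum>u\<in>clique_block 3 i. f u)"
    by (rule sum.UNION_disjoint) (auto simp: finite_clique_block mem_clique_block_3_iff)
  ultimately show ?thesis
    by (simp add: pverts_friendship finite_clique_block)
qed

lemma adj_friendship_centre:
  assumes "i < m" "u \<in> clique_block 3 i"
  shows "adj (gen_friendship 3 m) 0 u = 1" "adj (gen_friendship 3 m) u 0 = 1"
  using assms by (auto simp: adj_def gen_friendship_def Let_def)

lemma adj_friendship_centre_self: "adj (gen_friendship 3 m) 0 0 = 0"
  by (auto simp: adj_def gen_friendship_def Let_def mem_clique_block_3_iff)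

lemma adj_friendship_block:
  assumes "i < m" "w \<in> clique_block 3 i" "j < m" "u \<in> clique_block 3 j"
  shows "adj (gen_friendship 3 m) w u = of_bool (i = j) * (1 - of_bool (u = w))"
  using assms by (auto simp: adj_def gen_friendship_def Let_def mem_clique_block_3_iff)

lemma adj_row_sum_centre:
  "(\<Sum>u\<in>pverts (gen_friendship 3 m). c u * adj (gen_friendship 3 m) 0 u)
    = (\<Sum>i<m. \<Sum>u\<in>clique_block 3 i. c u)"
  unfolding sum_pverts_friendship adj_friendship_centre_self
  by (auto intro!: sum.cong simp: adj_friendship_centre)

lemma adj_row_sum_block:
  assumes "i < m" "w \<in> clique_block 3 i"
  shows "(\<Sum>u\<in>pverts (gen_friendship 3 m). c u * adj (gen_friendship 3 m) w u)
    = c 0 + (\<Sum>u\<in>clique_block 3 i. c u) - c w"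
proof -
  let ?A = "adj (gen_friendship 3 m)"
  have blk: "(\<Sum>u\<in>clique_block 3 j. c u * ?A w u)
      = (if j = i then (\<Sum>u\<in>clique_block 3 i. c u) - c w else 0)" if "j < m" for j
  proof (cases "j = i")
    case True
    have "(\<Sum>u\<in>clique_block 3 i. c u * ?A w u)
        = (\<Sum>u\<in>clique_block 3 i. c u - of_bool (u = w) * c u)"
      using assms by (intro sum.cong) (auto simp: adj_friendship_block)
    also have "\<dots> = (\<Sum>u\<in>clique_block 3 i. c u) - c w"
      unfolding sum_subtractf sum_of_bool_eq_mult[OF finite_clique_block assms(2)] ..
    finally show ?thesis using True by simp
  next
    case False
    have "(\<Sum>u\<in>clique_block 3 j. c u * ?A w u) = 0"
      using assms that False by (intro sum.neutral) (auto simp: adj_friendship_block)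
    then show ?thesis using False by simp
  qed
  have "(\<Sum>j<m. \<Sum>u\<in>clique_block 3 j. c u * ?A w u)
      = (\<Sum>j<m. if j = i then (\<Sum>u\<in>clique_block 3 i. c u) - c w else 0)"
    by (rule sum.cong) (simp_all add: blk)
  also have "\<dots> = (\<Sum>u\<in>clique_block 3 i. c u) - c w" using assms(1) by simp
  finally show ?thesis
    unfolding sum_pverts_friendship adj_friendship_centre(2)[OF assms] by simp
qed

text \<open>
  The unique solution \<open>c\<close> of \<open>A c = x\<close>. With \<open>t\<close> the value at the centre and \<open>S i\<close>, \<open>s i\<close> the sums of \<open>c\<close>
  and \<open>x\<close> over triangle \<open>i\<close>, the rows of this triangle read \<open>x w = t + S i - c w\<close>. Summing them gives
  \<open>s i = 3 t + 2 S i\<close>, and the central row \<open>x 0 = (\<Sum>i. S i)\<close> then determines \<open>t\<close>.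
\<close>

definition friendship_solution :: "nat \<Rightarrow> (nat \<Rightarrow> real) \<Rightarrow> nat \<Rightarrow> real" where
  "friendship_solution m x u =
    (let s = (\<lambda>i. \<Sum>w\<in>clique_block 3 i. x w);
         t = ((\<Sum>i<m. s i) - 2 * x 0) / (3 * m)
     in if u = 0 then t else (s ((u - 1) div 3) - t) / 2 - x u)"

lemma friendship_solution_centre:
  "friendship_solution m x 0 = ((\<Sum>i<m. \<Sum>w\<in>clique_block 3 i. x w) - 2 * x 0) / (3 * m)"
  by (simp add: friendship_solution_def)

lemma friendship_solution_block:
  assumes "u \<in> clique_block 3 i"
  shows "friendship_solution m x u
    = ((\<Sum>w\<in>clique_block 3 i. x w) - friendship_solution m x 0) / 2 - x u"
  using assms unfolding mem_clique_block_3_iff by (simp add: friendship_solution_def)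

lemma friendship_system_iff:
  assumes m: "m \<ge> 1"
  shows "(\<forall>w\<in>pverts (gen_friendship 3 m).
      x w = (\<Sum>u\<in>pverts (gen_friendship 3 m). c u * adj (gen_friendship 3 m) w u))
    \<longleftrightarrow> (\<forall>u\<in>pverts (gen_friendship 3 m). c u = friendship_solution m x u)"
    (is "?sys \<longleftrightarrow> ?sol")
proof -
  let ?s = "\<lambda>i. \<Sum>w\<in>clique_block 3 i. x w" and ?S = "\<lambda>i. \<Sum>w\<in>clique_block 3 i. c w"
  let ?t = "friendship_solution m x 0"
  have m0: "real m \<noteq> 0" using m by simp
  have sys: "?sys \<longleftrightarrow> x 0 = (\<Sum>i<m. ?S i) \<and>
      (\<forall>i<m. \<forall>w\<in>clique_block 3 i. x w = c 0 + ?S i - c w)" (is "_ \<longleftrightarrow> ?sys'")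
    unfolding pverts_friendship ball_simps(7) UN_ball_bex_simps(1)
    unfolding pverts_friendship[symmetric] adj_row_sum_centre
    by (auto simp: adj_row_sum_block)
  have sol: "?sol \<longleftrightarrow> c 0 = ?t \<and>
      (\<forall>i<m. \<forall>w\<in>clique_block 3 i. c w = (?s i - ?t) / 2 - x w)" (is "_ \<longleftrightarrow> ?sol'")
    unfolding pverts_friendship by (auto simp: friendship_solution_block)
  have "?sys'" if sol': "?sol'"
  proof -
    have S: "?S i = (?s i - 3 * ?t) / 2" if "i < m" for i
    proof -
      have "?S i = (\<Sum>w\<in>clique_block 3 i. (?s i - ?t) / 2 - x w)"
        by (rule sum.cong) (use that sol' in auto)
      also have "\<dots> = 3 * ((?s i - ?t) / 2) - ?s i"
        by (simp add: sum_subtractf card_clique_block)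
      finally show ?thesis by (simp add: field_simps)
    qed
    have "(\<Sum>i<m. ?S i) = (\<Sum>i<m. (?s i - 3 * ?t) / 2)"
      by (rule sum.cong) (simp_all add: S)
    also have "\<dots> = ((\<Sum>i<m. ?s i) - 3 * m * ?t) / 2"
      by (simp add: sum_divide_distrib[symmetric] sum_subtractf)
    also have "3 * m * ?t = (\<Sum>i<m. ?s i) - 2 * x 0"
      using m0 by (simp add: friendship_solution_centre)
    finally have "x 0 = (\<Sum>i<m. ?S i)" by simp
    moreover have "x w = c 0 + ?S i - c w" if iw: "i < m" "w \<in> clique_block 3 i" for i w
    proof -
      have "c 0 = ?t" "c w = (?s i - ?t) / 2 - x w" using sol' iw by blast+
      then show ?thesis using S[OF iw(1)] by (simp add: field_simps)
    qed
    ultimately show ?thesis by blast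
  qed
  moreover have "?sol'" if sys': "?sys'"
  proof -
    have s: "?s i = 3 * c 0 + 2 * ?S i" if "i < m" for i
    proof -
      have "?s i = (\<Sum>w\<in>clique_block 3 i. c 0 + ?S i - c w)"
        by (rule sum.cong) (use that sys' in auto)
      then show ?thesis by (simp add: sum_subtractf card_clique_block)
    qed
    have "(\<Sum>i<m. ?s i) = (\<Sum>i<m. 3 * c 0 + 2 * ?S i)"
      by (rule sum.cong) (simp_all add: s)
    also have "\<dots> = 3 * m * c 0 + 2 * x 0"
      using sys' by (simp add: sum.distrib sum_distrib_left[symmetric])
    finally have c0: "c 0 = ?t"
      using m0 by (simp add: friendship_solution_centre)
    moreover have "c w = (?s i - ?t) / 2 - x w" if iw: "i < m" "w \<in> clique_block 3 i" for i w
    proof -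
      have "x w = c 0 + ?S i - c w" using sys' iw by blast
      then show ?thesis using s[OF iw(1)] c0 by (simp add: field_simps)
    qed
    ultimately show ?thesis by blast
  qed
  ultimately show ?thesis unfolding sys sol by blast
qed

text \<open>
  The solution for \<open>x = 0\<close> is zero, so \<open>F(3, m)\<close> is nonsingular.
\<close>

lemma indep_cols_friendship:
  assumes "m \<ge> 1"
  shows "indep_cols (gen_friendship 3 m) (pverts (gen_friendship 3 m))"
  unfolding indep_cols_def
proof (intro allI impI ballI)
  fix c u
  assume "\<forall>w\<in>pverts (gen_friendship 3 m).
    (\<Sum>u\<in>pverts (gen_friendship 3 m). c u * adj (gen_friendship 3 m) w u) = 0"
    and u: "u \<in> pverts (gen_friendship 3 m)"
  then have "\<forall>u\<in>pverts (gen_friendship 3 m). c u = friendship_solution m (\<lambda>_. 0) u"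
    by (intro friendship_system_iff[OF assms, THEN iffD1]) simp
  then show "c u = 0" using u by (simp add: friendship_solution_def)
qed

text \<open>
  The entries of \<open>x\<close> are 0 or 1, so \<open>x u * x u = x u\<close>, and the sum of \<open>c u * x u\<close> over triangle \<open>i\<close>
  depends only on \<open>s i\<close> and \<open>t\<close>. Adding up, twice the total is \<open>N - t k\<close>, where \<open>3 m t = k\<close>.
\<close>

lemma friendship_solution_orthogonal_iff:
  assumes m: "m \<ge> 1" and X: "X \<subseteq> pverts (gen_friendship 3 m)"
  defines "s \<equiv> \<lambda>i. int (card (X \<inter> clique_block 3 i))"
  shows "(\<Sum>u\<in>X. friendship_solution m (\<lambda>w. of_bool (w \<in> X)) u) = 0
    \<longleftrightarrow> admissible_profile m (of_bool (0 \<in> X)) s"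
proof -
  let ?x = "\<lambda>w. of_bool (w \<in> X) :: real"
  let ?c = "friendship_solution m ?x"
  define t where "t = ?c 0"
  define S where "S = (\<Sum>i<m. real_of_int (s i))"
  define a where "a = ?x 0"
  have m0: "real m \<noteq> 0" using m by simp
  have sx: "(\<Sum>w\<in>clique_block 3 i. ?x w) = real_of_int (s i)" for i
    by (simp add: s_def finite_clique_block Int_commute)
  have t: "3 * m * t = S - 2 * a"
    using m0 by (simp add: t_def friendship_solution_centre sx S_def a_def)
  have block: "(\<Sum>u\<in>clique_block 3 i. ?c u * ?x u) = (real_of_int (s i) - t) / 2 * s i - s i" for i
  proof -
    have "(\<Sum>u\<in>clique_block 3 i. ?c u * ?x u)
        = (\<Sum>u\<in>clique_block 3 i. (real_of_int (s i) - t) / 2 * ?x u - ?x u)"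
      by (rule sum.cong) (auto simp: friendship_solution_block sx t_def)
    then show ?thesis by (simp only: sum_subtractf sum_distrib_left[symmetric] sx)
  qed
  have "(\<Sum>u\<in>X. ?c u) = (\<Sum>u\<in>pverts (gen_friendship 3 m). ?c u * ?x u)"
    using X finite_pverts_friendship[of m]
    by (simp add: of_bool_def if_distrib sum.inter_restrict[symmetric] Int_absorb1 cong: if_cong)
  also have "\<dots> = t * a + (\<Sum>i<m. \<Sum>u\<in>clique_block 3 i. ?c u * ?x u)"
    by (simp add: sum_pverts_friendship t_def a_def)
  also have "\<dots> = t * a + (\<Sum>i<m. (real_of_int (s i) - t) / 2 * s i - s i)"
    by (simp only: block)
  also have "\<dots>
      = ((\<Sum>i<m. real_of_int (s i) * (s i - 2)) - t * (S - 2 * a)) / 2"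
  proof -
    have "(\<Sum>i<m. (real_of_int (s i) - t) / 2 * s i - s i)
        = (\<Sum>i<m. real_of_int (s i) * (s i - 2) / 2 - t * s i / 2)"
      by (rule sum.cong) (simp_all add: field_simps)
    also have "\<dots> = (\<Sum>i<m. real_of_int (s i) * (s i - 2)) / 2 - t * S / 2"
      by (simp add: sum_subtractf sum_divide_distrib[symmetric] sum_distrib_left[symmetric] S_def)
    finally show ?thesis by (simp add: field_simps)
  qed
  finally have form: "(\<Sum>u\<in>X. ?c u)
      = ((\<Sum>i<m. real_of_int (s i) * (s i - 2)) - t * (S - 2 * a)) / 2" .
  have "(\<Sum>u\<in>X. ?c u) = 0 \<longleftrightarrow>
      (\<Sum>i<m. real_of_int (s i) * (s i - 2)) = t * (S - 2 * a)"
    unfolding form by simp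
  also have "\<dots> \<longleftrightarrow> 3 * m * (\<Sum>i<m. real_of_int (s i) * (s i - 2)) = 3 * m * (t * (S - 2 * a))"
    using m0 by simp
  also have "3 * m * (t * (S - 2 * a)) = (S - 2 * a)\<^sup>2"
    using t by (simp add: power2_eq_square mult.assoc[symmetric])
  also have "3 * m * (\<Sum>i<m. real_of_int (s i) * (s i - 2))
      = real_of_int (3 * int m * (\<Sum>i<m. s i * (s i - 2)))" by simp
  also have "(S - 2 * a)\<^sup>2 = real_of_int (((\<Sum>i<m. s i) - 2 * of_bool (0 \<in> X))\<^sup>2)"
    by (simp add: S_def a_def)
  also have "real_of_int (3 * int m * (\<Sum>i<m. s i * (s i - 2)))
        = real_of_int (((\<Sum>i<m. s i) - 2 * of_bool (0 \<in> X))\<^sup>2)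
      \<longleftrightarrow> admissible_profile m (of_bool (0 \<in> X)) s"
  proof -
    have "s i \<in> {0..3}" for i
      using card_mono[OF finite_clique_block[of 3 i], of "X \<inter> clique_block 3 i"]
      by (simp add: s_def card_clique_block)
    then show ?thesis unfolding admissible_profile_def of_int_eq_iff by simp
  qed
  finally show ?thesis .
qed

lemma maximal_friendship_iff:
  assumes m: "m \<ge> 1"
  shows "maximal_graph (gen_friendship 3 m) \<longleftrightarrow>
    (\<forall>X \<subseteq> pverts (gen_friendship 3 m).
      admissible_profile m (of_bool (0 \<in> X)) (\<lambda>i. int (card (X \<inter> clique_block 3 i)))
      \<longrightarrow> X = {} \<or> (\<exists>u\<in>pverts (gen_friendship 3 m). nbrs (gen_friendship 3 m) u = X))"
proof -
  let ?F = "gen_friendship 3 m"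
  have sol: "(\<exists>c. (\<forall>w\<in>pverts ?F. of_bool (w \<in> X) = (\<Sum>u\<in>pverts ?F. c u * adj ?F w u))
        \<and> (\<Sum>u\<in>X. c u) = 0)
      \<longleftrightarrow> admissible_profile m (of_bool (0 \<in> X)) (\<lambda>i. int (card (X \<inter> clique_block 3 i)))"
    if X: "X \<subseteq> pverts ?F" for X
  proof -
    let ?c = "friendship_solution m (\<lambda>w. of_bool (w \<in> X))"
    have "(\<Sum>u\<in>X. c u) = (\<Sum>u\<in>X. ?c u)" if "\<forall>u\<in>pverts ?F. c u = ?c u" for c
      by (rule sum.cong) (use that X in auto)
    then show ?thesis
      unfolding friendship_system_iff[OF m] friendship_solution_orthogonal_iff[OF m X, symmetric]
      by metis
  qed
  show ?thesis
    unfolding maximal_graph_nonsingular_iff[OF pair_graph_gen_friendship indep_cols_friendship[OF m]]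
    using sol by (smt (verit))
qed

lemma nbrs_friendship_centre: "nbrs (gen_friendship 3 m) 0 = (\<Union>i<m. clique_block 3 i)"
  by (auto simp: nbrs_def gen_friendship_def Let_def mem_clique_block_3_iff)

lemma nbrs_friendship_block:
  assumes "i < m" "u \<in> clique_block 3 i"
  shows "nbrs (gen_friendship 3 m) u = insert 0 (clique_block 3 i - {u})"
  using assms by (auto simp: nbrs_def gen_friendship_def Let_def mem_clique_block_3_iff)

lemma admissible_profile_cong:
  assumes "\<And>i. i < m \<Longrightarrow> s i = s' i"
  shows "admissible_profile m a s \<longleftrightarrow> admissible_profile m a s'"
proof -
  have "(\<Sum>i<m. f (s i)) = (\<Sum>i<m. f (s' i))" for f :: "int \<Rightarrow> int"
    by (rule sum.cong) (simp_all add: assms)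
  from this[of "\<lambda>x. x"] this[of "\<lambda>x. x * (x - 2)"] show ?thesis
    unfolding admissible_profile_def by (simp add: assms)
qed

lemma maximal_friendship_if_squarefree:
  assumes m: "m \<ge> 1" and sf: "squarefree (3 * m) \<or> (even m \<and> squarefree (3 * m div 2))"
  shows "maximal_graph (gen_friendship 3 m)"
  unfolding maximal_friendship_iff[OF m]
proof (intro allI impI)
  let ?F = "gen_friendship 3 m" and ?B = "clique_block 3"
  fix X assume X: "X \<subseteq> pverts ?F"
    and adm: "admissible_profile m (of_bool (0 \<in> X)) (\<lambda>i. int (card (X \<inter> ?B i)))"
  have X_cases: "w = 0 \<or> (\<exists>i<m. w \<in> X \<inter> ?B i)" if "w \<in> X" for w
    using X that unfolding pverts_friendship by blast
  have fin: "finite (X \<inter> ?B i)" for i by (simp add: finite_clique_block)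
  have full_block: "X \<inter> ?B i = ?B i" if "card (X \<inter> ?B i) = 3" for i
    using that by (intro card_subset_eq finite_clique_block) (simp_all add: card_clique_block)
  from m sf adm show "X = {} \<or> (\<exists>u\<in>pverts ?F. nbrs ?F u = X)"
  proof (cases rule: admissible_profile_cases)
    case zero
    have "X \<inter> ?B i = {}" if "i < m" for i using zero(2)[OF that] fin by simp
    moreover have "0 \<notin> X" using zero(1) by simp
    ultimately show ?thesis using X_cases by (metis empty_iff equals0I)
  next
    case full
    have "?B i \<subseteq> X" if "i < m" for i
      using full_block[of i] full(2)[OF that] by auto
    moreover have "0 \<notin> X" using full(1) by simp
    ultimately have "X = (\<Union>i<m. ?B i)"
      using X_cases by (intro equalityI subsetI) (metis IntD2 UN_I lessThan_iff, blast)
    then have "nbrs ?F 0 = X" by (simp only: nbrs_friendship_centre)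
    moreover have "0 \<in> pverts ?F" by (simp add: pverts_friendship)
    ultimately show ?thesis by blast
  next
    case (edge j)
    have "card (X \<inter> ?B j) = 2" using edge(3)[OF edge(2)] by simp
    then have "card (?B j - X) = 1"
      using card_Diff_subset_Int[of "?B j" X] fin[of j] by (simp add: Int_commute card_clique_block)
    then obtain u where u: "?B j - X = {u}" by (rule card_1_singletonE)
    then have uj: "u \<in> ?B j" "X \<inter> ?B j = ?B j - {u}" by blast+
    have others: "X \<inter> ?B i = {}" if "i < m" "i \<noteq> j" for i
      using edge(3)[OF that(1)] that(2) fin by simp
    have "0 \<in> X" using edge(1) by (cases "0 \<in> X") simp_all
    have "X = insert 0 (?B j - {u})"
    proof (intro equalityI subsetI)
      fix w assume "w \<in> X"
      then consider "w = 0" | i where "i < m" "w \<in> X \<inter> ?B i" using X_cases by blast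
      then show "w \<in> insert 0 (?B j - {u})"
      proof cases
        case 2
        then have "i = j" using others by blast
        then show ?thesis using 2(2) uj(2) by blast
      qed simp
    next
      fix w assume "w \<in> insert 0 (?B j - {u})"
      then show "w \<in> X" using uj(2) \<open>0 \<in> X\<close> by blast
    qed
    then have "nbrs ?F u = X" by (simp only: nbrs_friendship_block[OF edge(2) uj(1)])
    moreover have "u \<in> pverts ?F" unfolding pverts_friendship using uj(1) edge(2) by blast
    ultimately show ?thesis by blast
  qed
qed

text \<open>
  Any set \<open>X\<close> with the given profile works. It contains the centre and a whole triangle, while the
  neighbourhood of the centre does not contain the centre, and the neighbourhood of another vertex
  \<open>u\<close> meets only the triangle of \<open>u\<close> and misses \<open>u\<close>.
\<close>

lemma not_maximal_friendship_if_admissible_profile: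
  assumes m: "m \<ge> 1" and adm: "admissible_profile m 1 \<sigma>" and i: "i < m" "\<sigma> i = 3"
  shows "\<not> maximal_graph (gen_friendship 3 m)"
proof
  let ?F = "gen_friendship 3 m" and ?B = "clique_block 3"
  assume max: "maximal_graph ?F"
  have rg: "0 \<le> \<sigma> j \<and> \<sigma> j \<le> 3" if "j < m" for j
    using adm that by (simp add: admissible_profile_def)
  have "\<exists>Y. Y \<subseteq> ?B j \<and> card Y = nat (\<sigma> j)" if "j < m" for j
  proof -
    have "nat (\<sigma> j) \<le> card (?B j)" using rg[OF that] by (simp add: card_clique_block nat_le_iff)
    then show ?thesis by (metis obtain_subset_with_card_n)
  qed
  then obtain Y where Y: "\<And>j. j < m \<Longrightarrow> Y j \<subseteq> ?B j" "\<And>j. j < m \<Longrightarrow> card (Y j) = nat (\<sigma> j)"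
    by metis
  define X where "X = insert 0 (\<Union>j<m. Y j)"
  have X: "X \<subseteq> pverts ?F" using Y(1) unfolding X_def pverts_friendship by blast
  have XB: "X \<inter> ?B j = Y j" if "j < m" for j
  proof -
    have "0 \<notin> ?B j" by (simp add: mem_clique_block_3_iff)
    moreover have "Y l \<inter> ?B j = {}" if "l < m" "l \<noteq> j" for l
      using Y(1)[OF that(1)] that(2) by (auto simp: mem_clique_block_3_iff)
    ultimately show ?thesis using Y(1)[OF that] that unfolding X_def by blast
  qed
  have card: "int (card (X \<inter> ?B j)) = \<sigma> j" if "j < m" for j
    unfolding XB[OF that] Y(2)[OF that] using rg[OF that] by simp
  have "0 \<in> X" by (simp add: X_def)
  have "admissible_profile m (of_bool (0 \<in> X)) (\<lambda>j. int (card (X \<inter> ?B j)))"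
    using adm \<open>0 \<in> X\<close>
    by (subst admissible_profile_cong[where s' = \<sigma>]) (simp_all add: card)
  then obtain u where u: "u \<in> pverts ?F" "nbrs ?F u = X"
    using max X \<open>0 \<in> X\<close> unfolding maximal_friendship_iff[OF m] by blast
  have "X \<inter> ?B i = ?B i"
    using card[OF i(1)] i(2)
    by (intro card_subset_eq finite_clique_block) (simp_all add: card_clique_block)
  then have full: "?B i \<subseteq> X" by blast
  have "u \<noteq> 0"
  proof
    assume "u = 0"
    then have "0 \<in> nbrs ?F 0" using u(2) \<open>0 \<in> X\<close> by simp
    then show False by (simp add: nbrs_friendship_centre mem_clique_block_3_iff)
  qed
  then obtain j where j: "j < m" "u \<in> ?B j" using u(1) unfolding pverts_friendship by blast
  have sub: "?B i \<subseteq> insert 0 (?B j - {u})"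
    using full unfolding u(2)[symmetric] nbrs_friendship_block[OF j] .
  have "3 * i + 1 \<in> ?B i" by (simp add: mem_clique_block_3_iff)
  then have "3 * i + 1 \<in> ?B j" using sub by auto
  then have "i = j" by (simp add: mem_clique_block_3_iff)
  then have "u \<in> insert 0 (?B j - {u})" using sub j(2) by blast
  then show False using \<open>u \<noteq> 0\<close> by simp
qed

theorem theorem9:
  fixes m :: nat
  assumes "m \<ge> 1"
  shows "maximal_graph (gen_friendship 3 m) \<longleftrightarrow>
    squarefree (3 * m) \<or> (even m \<and> squarefree (3 * m div 2))"
proof
  assume max: "maximal_graph (gen_friendship 3 m)"
  show "squarefree (3 * m) \<or> (even m \<and> squarefree (3 * m div 2))"
  proof (rule ccontr)
    assume "\<not> ?thesis"
    then obtain \<sigma> where adm: "admissible_profile m 1 \<sigma>" and "\<exists>i<m. \<sigma> i = 3"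
      using exists_admissible_profile[OF assms] by blast
    then obtain i where i: "i < m" "\<sigma> i = 3" by blast
    show False
      using not_maximal_friendship_if_admissible_profile[OF assms adm i] max by contradiction
  qed
qed (rule maximal_friendship_if_squarefree[OF assms])

end
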